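(* Let $r\ge 2$, $n \ge 2$ be integers. If $F \in \mathcal{F}(r,n,1)$, then there is an integer $k$ with $m(r,n) \le k \le r-2$ such that $T(F) = \{1,\dots,k\}$ (the empty set if $k=0$).
   Context: For integers $r\ge 2$, $n \ge 2$, $d\ge 1$, $\mathcal{F}(r,n,d)$ denotes the set of families $F = \{f_1,\dots,f_r\}$ where each $f_j$ is a homogeneous polynomial over $\mathbb{C}$ in $n$ variables of degree $d$, and no two of the $f_j$ are proportional (two polynomials are proportional if one is a complex scalar multiple of the other; in particular all $f_j$ are nonzero). The ticket of $F$ is $T(F) = \{m \in \mathbb{N} : f_1^m,\dots,f_r^m \text{ are linearly dependent over } \mathbb{C}\}$, where $\mathbb{N}$ denotes the positive integers. The number $m(r,n)$ is the largest integer $m\ge 0$ such that $r > \binom{n+m-1}{n-1}$. *)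

theory Defs
  imports Complex_Main "HOL-Library.Poly_Mapping"
begin

text \<open>
  Polynomials over the complex numbers: a monomial is a finitely supported exponent vector,
  and a polynomial is a finitely supported map from monomials to coefficients. Multiplication
  is the convolution product of \<^theory>\<open>HOL-Library.Poly_Mapping\<close>. The polynomials in \<open>n\<close> variables
  are those in which only the variables with indices \<open>0, \<dots>, n - 1\<close> occur.
\<close>

type_synonym cpoly = "(nat \<Rightarrow>\<^sub>0 nat) \<Rightarrow>\<^sub>0 complex"

definition in_vars :: "nat \<Rightarrow> cpoly \<Rightarrow> bool" where
  "in_vars n p \<longleftrightarrow> (\<forall>t \<in> Poly_Mapping.keys p. Poly_Mapping.keys t \<subseteq> {..<n})"

definition total_deg :: "(nat \<Rightarrow>\<^sub>0 nat) \<Rightarrow> nat" where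
  "total_deg t = (\<Sum>i \<in> Poly_Mapping.keys t. Poly_Mapping.lookup t i)"

text \<open>The zero polynomial is homogeneous of every degree.\<close>

definition homogeneous :: "nat \<Rightarrow> cpoly \<Rightarrow> bool" where
  "homogeneous d p \<longleftrightarrow> (\<forall>t \<in> Poly_Mapping.keys p. total_deg t = d)"

definition scale :: "complex \<Rightarrow> cpoly \<Rightarrow> cpoly" where
  "scale c p = Poly_Mapping.map ((*) c) p"

definition proportional :: "cpoly \<Rightarrow> cpoly \<Rightarrow> bool" where
  "proportional p q \<longleftrightarrow> (\<exists>c. p = scale c q \<or> q = scale c p)"

text \<open>
  Linear dependence of the indexed family \<open>g 1, \<dots>, g r\<close> (a repeated member makes the family
  dependent).
\<close>

definition lin_dependent :: "nat \<Rightarrow> (nat \<Rightarrow> cpoly) \<Rightarrow> bool" where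
  "lin_dependent r g \<longleftrightarrow>
     (\<exists>c. (\<exists>j \<in> {1..r}. c j \<noteq> 0) \<and> (\<Sum>j = 1..r. scale (c j) (g j)) = 0)"

text \<open>
  A family \<open>{f 1, \<dots>, f r}\<close> is given by an enumeration, of which only the values at \<open>1, \<dots>, r\<close>
  matter. Non-proportionality makes the members distinct and, for \<open>r \<ge> 2\<close>, nonzero, since \<open>0\<close> is
  proportional to every polynomial.
\<close>

definition families :: "nat \<Rightarrow> nat \<Rightarrow> nat \<Rightarrow> (nat \<Rightarrow> cpoly) set" where
  "families r n d =
     {f. (\<forall>j \<in> {1..r}. in_vars n (f j) \<and> homogeneous d (f j)) \<and>
         (\<forall>i \<in> {1..r}. \<forall>j \<in> {1..r}. i \<noteq> j \<longrightarrow> \<not> proportional (f i) (f j))}"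

definition ticket :: "nat \<Rightarrow> (nat \<Rightarrow> cpoly) \<Rightarrow> nat set" where
  "ticket r f = {m. 1 \<le> m \<and> lin_dependent r (\<lambda>j. f j ^ m)}"

text \<open>For \<open>r, n \<ge> 2\<close> the maximum exists: \<open>m = 0\<close> qualifies and the binomial coefficient is
  unbounded in \<open>m\<close>.\<close>

definition m_bound :: "nat \<Rightarrow> nat \<Rightarrow> nat" where
  "m_bound r n = (GREATEST m. r > (n + m - 1) choose (n - 1))"

end

theory Submission imports Defs begin

text \<open>
  Let \<open>f j\<close> be linear forms with coefficients \<open>a j i\<close>, pairwise non-proportional. A relation
  \<open>\<Sum>j. c j * f j ^ (m + 1) = 0\<close> differentiated along the variable \<open>i\<close> gives, because
  \<open>\<partial>\<^sub>i (f j ^ (m + 1)) = (m + 1) * a j i * f j ^ m\<close>, the relation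
  \<open>\<Sum>j. (c j * a j i) * f j ^ m = 0\<close> (lemma \<open>power_relation_pdiff\<close>). A directional derivative
  thus lowers the exponent by one and multiplies the coefficient \<open>c j\<close> by the value \<open>L (a j)\<close>
  of a linear functional \<open>L\<close> that can be chosen freely. Everything but the lower bound on the
  length of the ticket comes from the choice of \<open>L\<close>.

  If \<open>L\<close> does not vanish at some \<open>a j\<close> with \<open>c j \<noteq> 0\<close>, then the new relation is nontrivial.
  So the ticket is closed downwards, and is an initial segment of the positive integers
  (\<open>ticket_downward_closed\<close>).

  If \<open>r - 1\<close> were in the ticket, fix \<open>j0\<close> with \<open>c j0 \<noteq> 0\<close>. Since \<open>a k\<close> is not a multiple of
  \<open>a j0\<close>, some functional vanishes at \<open>a k\<close> but not at \<open>a j0\<close>. Using one such functional for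
  each of the \<open>r - 1\<close> indices \<open>k \<noteq> j0\<close> leaves a relation among zeroth powers whose only
  coefficient that is not zero belongs to \<open>j0\<close>, which is absurd. Hence the ticket ends at
  \<open>r - 2\<close> at the latest (\<open>ticket_upper_bound\<close>).

  Finally, the \<open>m\<close>-th powers lie in the span of the monomials of degree \<open>m\<close> in \<open>n\<close> variables,
  of which there are \<open>(n + m - 1) choose (n - 1)\<close>. More than that many powers are dependent,
  so the ticket reaches at least \<open>m_bound r n\<close> (\<open>ticket_contains\<close>).
\<close>

section \<open>Partial derivatives\<close>

lemma scale_eq_mult: "scale c p = Poly_Mapping.single 0 c * p"
  by (simp add: scale_def mult_map_scale_conv_mult)

lemma lookup_scale: "Poly_Mapping.lookup (scale c p) t = c * Poly_Mapping.lookup p t"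
  by (simp add: scale_def map.rep_eq when_def)

text \<open>
  In terms of coefficients, differentiating along variable \<open>i\<close> moves the coefficient of
  \<open>x\<^sub>i * x\<^sup>t\<close> to \<open>x\<^sup>t\<close>, multiplied by the exponent of \<open>x\<^sub>i\<close> in \<open>x\<^sub>i * x\<^sup>t\<close>. Reindexing along the
  injective shift of exponents keeps the support finite without a separate argument.
\<close>

definition pdiff :: "nat \<Rightarrow> cpoly \<Rightarrow> cpoly" where
  "pdiff i p = Poly_Mapping.mapp (\<lambda>t c. of_nat (Suc (Poly_Mapping.lookup t i)) * c)
     (Poly_Mapping.map_key ((+) (Poly_Mapping.single i 1)) p)"

lemma lookup_pdiff:
  "Poly_Mapping.lookup (pdiff i p) t =
     of_nat (Suc (Poly_Mapping.lookup t i)) * Poly_Mapping.lookup p (Poly_Mapping.single i 1 + t)"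
  by (simp add: pdiff_def lookup_mapp map_key.rep_eq when_def in_keys_iff)

lemma pdiff_add: "pdiff i (p + q) = pdiff i p + pdiff i q"
  by (rule poly_mapping_eqI) (simp add: lookup_pdiff lookup_add algebra_simps)

lemma pdiff_0: "pdiff i 0 = 0"
  by (rule poly_mapping_eqI) (simp add: lookup_pdiff)

lemma pdiff_sum: "pdiff i (sum p A) = (\<Sum>j\<in>A. pdiff i (p j))"
  by (induction A rule: infinite_finite_induct) (simp_all add: pdiff_0 pdiff_add)

lemma pdiff_scale: "pdiff i (scale c p) = scale c (pdiff i p)"
  by (rule poly_mapping_eqI) (simp add: lookup_pdiff lookup_scale)

text \<open>
  If \<open>x\<^sub>i\<close> does not occur in the monomial \<open>s\<close>, the truncated difference on the right is the wrong
  exponent, but its coefficient is zero.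
\<close>

lemma pdiff_single:
  "pdiff i (Poly_Mapping.single s a) =
     Poly_Mapping.single (s - Poly_Mapping.single i 1) (of_nat (Poly_Mapping.lookup s i) * a)"
proof (cases "Poly_Mapping.lookup s i")
  case 0
  then have "s \<noteq> Poly_Mapping.single i 1 + t" for t
    by (metis add_is_0 lookup_add lookup_single_eq one_neq_zero)
  with 0 show ?thesis
    by (intro poly_mapping_eqI) (simp add: lookup_pdiff lookup_single when_def)
next
  case (Suc k)
  define s' where "s' = s - Poly_Mapping.single i (1::nat)"
  have s: "s = Poly_Mapping.single i 1 + s'"
    using Suc by (intro poly_mapping_eqI)
      (auto simp: s'_def lookup_add lookup_minus lookup_single when_def)
  show ?thesis
  proof (rule poly_mapping_eqI)
    fix t
    show "Poly_Mapping.lookup (pdiff i (Poly_Mapping.single s a)) t =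
        Poly_Mapping.lookup (Poly_Mapping.single (s - Poly_Mapping.single i 1)
          (of_nat (Poly_Mapping.lookup s i) * a)) t"
      unfolding s
      by (cases "s' = t") (simp_all add: lookup_pdiff lookup_single lookup_add)
  qed
qed

lemma poly_mapping_induct_single [case_names zero add]:
  fixes p :: "'a \<Rightarrow>\<^sub>0 'b::comm_monoid_add"
  assumes "P 0" and "\<And>t a p. P p \<Longrightarrow> P (Poly_Mapping.single t a + p)"
  shows "P p"
proof (induction p rule: update_induct)
  case const
  show ?case by (rule assms(1))
next
  case (update f t a)
  then have "Poly_Mapping.update t a f = Poly_Mapping.single t a + f"
    by (intro poly_mapping_eqI)
      (auto simp: lookup_update lookup_add lookup_single in_keys_iff when_def)
  with assms(2)[OF update(3)] show ?case by simp
qed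

lemma pdiff_mult_single:
  "pdiff i (Poly_Mapping.single s a * Poly_Mapping.single t b) =
     pdiff i (Poly_Mapping.single s a) * Poly_Mapping.single t b
     + Poly_Mapping.single s a * pdiff i (Poly_Mapping.single t b)"
proof -
  let ?e = "Poly_Mapping.single i (1::nat)"
  \<comment> \<open>truncated subtraction commutes with adding \<open>v\<close> only if \<open>x\<^sub>i\<close> occurs in \<open>u\<close>; otherwise both
    coefficients vanish\<close>
  have shift: "Poly_Mapping.single ((u - ?e) + v) (of_nat (Poly_Mapping.lookup u i) * c) =
      Poly_Mapping.single (u + v - ?e) (of_nat (Poly_Mapping.lookup u i) * c)" for u v and c :: complex
  proof (cases "Poly_Mapping.lookup u i = 0")
    case False
    then have "(u - ?e) + v = u + v - ?e"
      by (intro poly_mapping_eqI) (auto simp: lookup_add lookup_minus lookup_single when_def)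
    then show ?thesis by simp
  qed simp
  have "pdiff i (Poly_Mapping.single s a) * Poly_Mapping.single t b =
      Poly_Mapping.single (s + t - ?e) (of_nat (Poly_Mapping.lookup s i) * (a * b))"
    using shift[of s t "a * b"] by (simp add: pdiff_single mult_single mult.assoc)
  moreover have "Poly_Mapping.single s a * pdiff i (Poly_Mapping.single t b) =
      Poly_Mapping.single (s + t - ?e) (of_nat (Poly_Mapping.lookup t i) * (a * b))"
    using shift[of t s "a * b"]
    by (simp add: pdiff_single mult_single mult.left_commute add.commute)
  ultimately show ?thesis
    by (simp only: mult_single pdiff_single[of i "s + t"] lookup_add of_nat_add distrib_right single_add)
qed

text \<open>
  Both sides are additive in each factor, so the product rule needs a check on single terms only.
\<close>

lemma pdiff_mult: "pdiff i (p * q) = pdiff i p * q + p * pdiff i q"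
proof (induction p rule: poly_mapping_induct_single)
  case zero
  show ?case by (simp add: pdiff_0)
next
  case (add s a p)
  have "pdiff i (Poly_Mapping.single s a * q) =
      pdiff i (Poly_Mapping.single s a) * q + Poly_Mapping.single s a * pdiff i q"
  proof (induction q rule: poly_mapping_induct_single)
    case zero
    show ?case by (simp add: pdiff_0)
  next
    case (add t b q)
    show ?case
      by (simp only: pdiff_add pdiff_mult_single distrib_left add add.assoc add.left_commute)
  qed
  then show ?case
    by (simp only: pdiff_add distrib_right add add.assoc add.left_commute)
qed

lemma pdiff_power_Suc: "pdiff i (p ^ Suc m) = of_nat (Suc m) * (p ^ m * pdiff i p)"
proof (induction m)
  case 0
  show ?case by simp
next
  case (Suc m)
  have "pdiff i (p ^ Suc (Suc m)) = pdiff i p * p ^ Suc m + p * pdiff i (p ^ Suc m)"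
    by (subst power_Suc) (rule pdiff_mult)
  also have "\<dots> = p ^ Suc m * pdiff i p + of_nat (Suc m) * (p ^ Suc m * pdiff i p)"
    unfolding Suc by (simp only: power_Suc ac_simps)
  also have "\<dots> = of_nat (Suc (Suc m)) * (p ^ Suc m * pdiff i p)"
    by (simp only: of_nat_Suc[of "Suc m"] distrib_right mult_1_left)
  finally show ?case .
qed


section \<open>Homogeneous polynomials\<close>

lemma total_deg_superset:
  assumes "finite A" and "Poly_Mapping.keys t \<subseteq> A"
  shows "total_deg t = (\<Sum>i\<in>A. Poly_Mapping.lookup t i)"
  unfolding total_deg_def using assms
  by (intro sum.mono_neutral_left) (auto simp: in_keys_iff)

lemma total_deg_add: "total_deg (s + t) = total_deg s + total_deg t"
proof -
  let ?A = "Poly_Mapping.keys s \<union> Poly_Mapping.keys t"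
  have "finite ?A" "Poly_Mapping.keys (s + t) \<subseteq> ?A"
    by (auto simp: keys_add)
  then show ?thesis
    by (simp add: total_deg_superset[of ?A] lookup_add sum.distrib)
qed

lemma total_deg_eq_0_iff: "total_deg t = 0 \<longleftrightarrow> t = 0"
proof
  assume "total_deg t = 0"
  then have "Poly_Mapping.lookup t i = 0" if "i \<in> Poly_Mapping.keys t" for i
    using that unfolding total_deg_def by (subst (asm) sum_eq_0_iff) auto
  then have "Poly_Mapping.keys t = {}"
    by (intro equals0I) (simp add: in_keys_iff)
  then show "t = 0" by simp
qed (simp add: total_deg_def)

lemma keys_multE:
  assumes "t \<in> Poly_Mapping.keys (p * q)"
  obtains u v where "t = u + v" "u \<in> Poly_Mapping.keys p" "v \<in> Poly_Mapping.keys q"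
  using subsetD[OF keys_mult assms] by blast

lemma homogeneous_mult:
  "homogeneous d p \<Longrightarrow> homogeneous e q \<Longrightarrow> homogeneous (d + e) (p * q)"
  unfolding homogeneous_def by (auto elim!: keys_multE simp: total_deg_add)

lemma homogeneous_power: "homogeneous d p \<Longrightarrow> homogeneous (m * d) (p ^ m)"
  by (induction m) (simp_all add: homogeneous_mult, simp add: homogeneous_def total_deg_def)

lemma in_vars_mult:
  assumes "in_vars n p" and "in_vars n q"
  shows "in_vars n (p * q)"
  unfolding in_vars_def
proof
  fix t assume "t \<in> Poly_Mapping.keys (p * q)"
  then obtain u v where "t = u + v" "u \<in> Poly_Mapping.keys p" "v \<in> Poly_Mapping.keys q"
    by (rule keys_multE)
  with assms show "Poly_Mapping.keys t \<subseteq> {..<n}"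
    using keys_add[of u v] unfolding in_vars_def by blast
qed

lemma in_vars_power: "in_vars n p \<Longrightarrow> in_vars n (p ^ m)"
  by (induction m) (simp_all add: in_vars_mult, simp add: in_vars_def)

lemma total_deg_single: "total_deg (Poly_Mapping.single i a) = a"
  by (simp add: total_deg_def)

lemma homogeneous_lookup_eq_0:
  "homogeneous d p \<Longrightarrow> total_deg t \<noteq> d \<Longrightarrow> Poly_Mapping.lookup p t = 0"
  unfolding homogeneous_def using in_keys_iff by metis

lemma total_deg_1E:
  assumes "total_deg t = 1"
  obtains i where "t = Poly_Mapping.single i 1"
proof -
  have "t \<noteq> 0" using assms by (auto simp: total_deg_def)
  then obtain i where i: "Poly_Mapping.lookup t i \<noteq> 0"
    by (metis lookup_zero poly_mapping_eqI)
  define s where "s = t - Poly_Mapping.single i 1"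
  have t: "t = Poly_Mapping.single i 1 + s"
    using i by (intro poly_mapping_eqI)
      (auto simp: s_def lookup_add lookup_minus lookup_single when_def)
  have "total_deg s = 0"
    using assms total_deg_add[of "Poly_Mapping.single i 1" s] t by (simp add: total_deg_single)
  then have "s = 0"
    by (simp add: total_deg_eq_0_iff)
  with t that[of i] show thesis by simp
qed

text \<open>
  The coefficients \<open>lin_coeff p 0, lin_coeff p 1, \<dots>\<close> are the coordinates of a linear form; they
  determine it, which turns proportionality of forms into proportionality of vectors.
\<close>

definition lin_coeff :: "cpoly \<Rightarrow> nat \<Rightarrow> complex" where
  "lin_coeff p i = Poly_Mapping.lookup p (Poly_Mapping.single i 1)"

lemma linear_form_eqI:
  assumes "homogeneous 1 p" and "homogeneous 1 q" and "\<And>i. lin_coeff p i = lin_coeff q i"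
  shows "p = q"
proof (rule poly_mapping_eqI)
  fix t
  show "Poly_Mapping.lookup p t = Poly_Mapping.lookup q t"
  proof (cases "total_deg t = 1")
    case True
    then obtain i where "t = Poly_Mapping.single i 1" by (rule total_deg_1E)
    with assms(3)[of i] show ?thesis by (simp add: lin_coeff_def)
  next
    case False
    with assms(1,2) show ?thesis by (simp add: homogeneous_lookup_eq_0)
  qed
qed

lemma pdiff_linear_form:
  assumes "homogeneous 1 p"
  shows "pdiff i p = Poly_Mapping.single 0 (lin_coeff p i)"
proof (rule poly_mapping_eqI)
  fix t
  have "Poly_Mapping.lookup p (Poly_Mapping.single i 1 + t) = 0" if "t \<noteq> 0"
    using that by (intro homogeneous_lookup_eq_0[OF assms])
      (simp add: total_deg_add total_deg_single total_deg_eq_0_iff)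
  then show "Poly_Mapping.lookup (pdiff i p) t =
      Poly_Mapping.lookup (Poly_Mapping.single 0 (lin_coeff p i)) t"
    by (cases "t = 0") (auto simp: lookup_pdiff lookup_single lin_coeff_def)
qed

lemma homogeneous_scale: "homogeneous d p \<Longrightarrow> homogeneous d (scale c p)"
  unfolding homogeneous_def Ball_def in_keys_iff lookup_scale by simp

lemma lin_coeff_scale: "lin_coeff (scale c p) i = c * lin_coeff p i"
  by (simp add: lin_coeff_def lookup_scale)

text \<open>
  Vectors that are not proportional form a matrix of rank two, which has a nonzero minor of size
  two. With \<open>q\<close> and the indices fixed, this minor is a linear functional of \<open>p\<close> that vanishes
  at \<open>q\<close>.
\<close>

lemma nonproportional_linear_forms_minor:
  assumes "homogeneous 1 p" and "homogeneous 1 q" and "\<not> proportional p q"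
  obtains i l where "lin_coeff p i * lin_coeff q l \<noteq> lin_coeff p l * lin_coeff q i"
proof (rule ccontr)
  \<comment> \<open>if all minors vanish, \<open>p\<close> is the multiple of \<open>q\<close> read off at a nonzero coordinate of \<open>q\<close>\<close>
  assume "\<not> thesis"
  with that have minors: "lin_coeff p i * lin_coeff q l = lin_coeff p l * lin_coeff q i" for i l
    by blast
  have "q \<noteq> scale 0 p"
    using assms(3) by (auto simp: proportional_def)
  then obtain l where l: "lin_coeff q l \<noteq> 0"
    using linear_form_eqI[OF assms(2) homogeneous_scale[OF assms(1)], of 0]
    by (auto simp: lin_coeff_scale)
  have "p = scale (lin_coeff p l / lin_coeff q l) q"
    using l minors[of _ l] assms(1,2)
    by (intro linear_form_eqI) (simp_all add: homogeneous_scale lin_coeff_scale field_simps)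
  with assms(3) show False by (auto simp: proportional_def)
qed


section \<open>Relations between powers of linear forms\<close>

definition power_relation :: "nat set \<Rightarrow> (nat \<Rightarrow> cpoly) \<Rightarrow> nat \<Rightarrow> (nat \<Rightarrow> complex) \<Rightarrow> bool" where
  "power_relation J f m c \<longleftrightarrow> (\<Sum>j\<in>J. scale (c j) (f j ^ m)) = 0"

lemma ticket_iff_power_relation:
  "m \<in> ticket r f \<longleftrightarrow> 1 \<le> m \<and> (\<exists>c. (\<exists>j\<in>{1..r}. c j \<noteq> 0) \<and> power_relation {1..r} f m c)"
  by (simp add: ticket_def lin_dependent_def power_relation_def)

text \<open>
  The relation is differentiated along variable \<open>i\<close>: each linear form has a constant derivative,
  its coefficient, and the common factor \<open>m + 1\<close> is cancelled.
\<close>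

lemma power_relation_pdiff:
  assumes "power_relation J f (Suc m) c" and "\<And>j. j \<in> J \<Longrightarrow> homogeneous 1 (f j)"
  shows "power_relation J f m (\<lambda>j. c j * lin_coeff (f j) i)"
proof -
  have "0 = pdiff i (\<Sum>j\<in>J. scale (c j) (f j ^ Suc m))"
    using assms(1) by (simp add: power_relation_def pdiff_0)
  also have "\<dots> = (\<Sum>j\<in>J. of_nat (Suc m) * scale (c j * lin_coeff (f j) i) (f j ^ m))"
    unfolding pdiff_sum
  proof (rule sum.cong)
    fix j assume "j \<in> J"
    then have "pdiff i (scale (c j) (f j ^ Suc m)) =
        scale (c j) (of_nat (Suc m) * (f j ^ m * Poly_Mapping.single 0 (lin_coeff (f j) i)))"
      using assms(2) by (simp only: pdiff_scale pdiff_power_Suc pdiff_linear_form)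
    also have "\<dots> = of_nat (Suc m) * ((Poly_Mapping.single 0 (c j) * Poly_Mapping.single 0 (lin_coeff (f j) i))
          * f j ^ m)"
      by (simp only: scale_eq_mult ac_simps)
    finally show "pdiff i (scale (c j) (f j ^ Suc m)) =
        of_nat (Suc m) * scale (c j * lin_coeff (f j) i) (f j ^ m)"
      by (simp only: mult_single scale_eq_mult add_0_left)
  qed simp
  also have "\<dots> = of_nat (Suc m) * (\<Sum>j\<in>J. scale (c j * lin_coeff (f j) i) (f j ^ m))"
    by (simp only: sum_distrib_left)
  finally have "of_nat (Suc m) * (\<Sum>j\<in>J. scale (c j * lin_coeff (f j) i) (f j ^ m)) = 0"
    by (rule sym)
  moreover have "(of_nat (Suc m) :: cpoly) \<noteq> 0"
    by (rule of_nat_neq_0)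
  ultimately show ?thesis
    unfolding power_relation_def mult_eq_0_iff by blast
qed

lemma power_relation_linear_combination:
  assumes "power_relation J f m c" and "power_relation J f m c'"
  shows "power_relation J f m (\<lambda>j. x * c j + y * c' j)"
proof -
  have "(\<Sum>j\<in>J. scale (x * c j + y * c' j) (f j ^ m)) =
     scale x (\<Sum>j\<in>J. scale (c j) (f j ^ m)) + scale y (\<Sum>j\<in>J. scale (c' j) (f j ^ m))"
    by (rule poly_mapping_eqI)
      (simp add: lookup_scale lookup_sum lookup_add sum.distrib sum_distrib_left algebra_simps)
  with assms show ?thesis
    by (simp add: power_relation_def scale_eq_mult)
qed

text \<open>
  One differentiation per \<open>k\<close> in \<open>K\<close>, in a direction that kills \<open>f k\<close> but not \<open>f j0\<close>, removes
  the members indexed by \<open>K\<close> from the relation. Every step multiplies the coefficients, so the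
  ones that are already zero stay zero; the last conjunct carries this through the induction.
\<close>

lemma power_relation_eliminate:
  assumes hom: "\<And>j. j \<in> J \<Longrightarrow> homogeneous 1 (f j)"
    and nonprop: "\<And>k. k \<in> K \<Longrightarrow> \<not> proportional (f j0) (f k)"
    and "j0 \<in> J" and "finite K" and "K \<subseteq> J"
    and "power_relation J f (card K + m) c" and "c j0 \<noteq> 0"
  shows "\<exists>c'. power_relation J f m c' \<and> c' j0 \<noteq> 0 \<and> (\<forall>k\<in>K. c' k = 0) \<and>
    (\<forall>j. c j = 0 \<longrightarrow> c' j = 0)"
  using \<open>finite K\<close> nonprop \<open>K \<subseteq> J\<close> \<open>power_relation J f (card K + m) c\<close> \<open>c j0 \<noteq> 0\<close>
proof (induction K arbitrary: c rule: finite_induct)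
  case empty
  then show ?case by auto
next
  case (insert k K)
  obtain i l where il: "lin_coeff (f j0) i * lin_coeff (f k) l \<noteq> lin_coeff (f j0) l * lin_coeff (f k) i"
    using nonproportional_linear_forms_minor[of "f j0" "f k"] hom \<open>j0 \<in> J\<close> insert.prems by auto
  \<comment> \<open>the value at \<open>f j\<close> of the functional that kills \<open>f k\<close> and not \<open>f j0\<close>\<close>
  define L where "L j = lin_coeff (f j) i * lin_coeff (f k) l - lin_coeff (f j) l * lin_coeff (f k) i" for j
  have rel: "power_relation J f (Suc (card K + m)) c"
    using insert by simp
  have "power_relation J f (card K + m)
      (\<lambda>j. lin_coeff (f k) l * (c j * lin_coeff (f j) i) + (- lin_coeff (f k) i) * (c j * lin_coeff (f j) l))"
    by (intro power_relation_linear_combination power_relation_pdiff rel hom)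
  then have "power_relation J f (card K + m) (\<lambda>j. c j * L j)"
    by (simp add: L_def algebra_simps)
  moreover have "c j0 * L j0 \<noteq> 0"
    using il insert.prems by (simp add: L_def)
  ultimately obtain c' where c': "power_relation J f m c'" "c' j0 \<noteq> 0" "\<forall>k\<in>K. c' k = 0"
      "\<forall>j. c j * L j = 0 \<longrightarrow> c' j = 0"
    using insert.IH[of "\<lambda>j. c j * L j"] insert.prems by auto
  moreover have "L k = 0"
    by (simp add: L_def)
  ultimately show ?case by auto
qed


section \<open>The ticket of a family of linear forms\<close>

lemma linear_family_homogeneous: "f \<in> families r n 1 \<Longrightarrow> j \<in> {1..r} \<Longrightarrow> homogeneous 1 (f j)"
  by (simp add: families_def)

lemma family_nonproportional:
  "f \<in> families r n d \<Longrightarrow> i \<in> {1..r} \<Longrightarrow> j \<in> {1..r} \<Longrightarrow> i \<noteq> j \<Longrightarrow> \<not> proportional (f i) (f j)"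
  by (simp add: families_def)

text \<open>
  The given relation has a member \<open>f j\<close> with nonzero coefficient. As \<open>f j\<close> is not zero (it has a
  partner to which it is not proportional), some variable occurs in it, and differentiating
  along this variable keeps the coefficient of \<open>f j\<close> nonzero.
\<close>

lemma ticket_pred:
  assumes "r \<ge> 2" and F: "f \<in> families r n 1" and "Suc m \<in> ticket r f" and "m \<ge> 1"
  shows "m \<in> ticket r f"
proof -
  obtain c j where cj: "j \<in> {1..r}" "c j \<noteq> 0" and rel: "power_relation {1..r} f (Suc m) c"
    using assms(3) by (auto simp: ticket_iff_power_relation)
  obtain k where k: "k \<in> {1..r}" "k \<noteq> j"
  proof (cases "j = 1")
    case True with that[of 2] \<open>r \<ge> 2\<close> show ?thesis by auto
  next
    case False with that[of 1] \<open>r \<ge> 2\<close> show ?thesis by auto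
  qed
  obtain i where "lin_coeff (f j) i \<noteq> 0"
    using nonproportional_linear_forms_minor[of "f j" "f k"] linear_family_homogeneous[OF F]
      family_nonproportional[OF F] cj(1) k by (metis mult_zero_left)
  with cj power_relation_pdiff[OF rel linear_family_homogeneous[OF F], of i] \<open>m \<ge> 1\<close>
  show ?thesis
    unfolding ticket_iff_power_relation
    by (intro conjI exI[of _ "\<lambda>j. c j * lin_coeff (f j) i"]) auto
qed

lemma ticket_downward_closed:
  assumes "r \<ge> 2" and "f \<in> families r n 1" and "m \<in> ticket r f" and "1 \<le> k" and "k \<le> m"
  shows "k \<in> ticket r f"
  using \<open>k \<le> m\<close> \<open>m \<in> ticket r f\<close>
proof (induction m rule: dec_induct)
  case (step m)
  with ticket_pred[OF assms(1,2)] \<open>1 \<le> k\<close> show ?case by simp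
qed simp

text \<open>
  An element above \<open>r - 2\<close> would put \<open>r - 1\<close> itself into the ticket. That exponent is just large
  enough to eliminate the \<open>r - 1\<close> members other than one with nonzero coefficient, and what is
  left is a nonzero multiple of a zeroth power.
\<close>

lemma ticket_upper_bound:
  assumes "r \<ge> 2" and F: "f \<in> families r n 1" and "m \<in> ticket r f"
  shows "m \<le> r - 2"
proof (rule ccontr)
  assume "\<not> m \<le> r - 2"
  then have "r - 1 \<in> ticket r f"
    using assms ticket_downward_closed[OF assms, of "r - 1"] by simp
  then obtain c j0 where j0: "j0 \<in> {1..r}" "c j0 \<noteq> 0"
    and rel: "power_relation {1..r} f (r - 1) c"
    by (auto simp: ticket_iff_power_relation)
  obtain c' where c': "power_relation {1..r} f 0 c'" "c' j0 \<noteq> 0" "\<forall>k\<in>{1..r} - {j0}. c' k = 0"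
    using power_relation_eliminate[of "{1..r}" f "{1..r} - {j0}" j0 0 c]
      linear_family_homogeneous[OF F] family_nonproportional[OF F] j0 rel
    by auto
  have "(\<Sum>j\<in>{1..r}. scale (c' j) (f j ^ 0)) = scale (c' j0) 1"
    using j0 c'(3) by (subst sum.remove[of _ j0]) (simp_all add: scale_eq_mult)
  with c'(1) have "scale (c' j0) 1 = 0"
    by (simp add: power_relation_def)
  then have "Poly_Mapping.lookup (scale (c' j0) 1) 0 = 0"
    by simp
  with c'(2) show False
    by (simp only: lookup_scale) (simp add: lookup_one)
qed


section \<open>Counting monomials\<close>

definition monomials :: "nat \<Rightarrow> nat \<Rightarrow> (nat \<Rightarrow>\<^sub>0 nat) set" where
  "monomials n m = {t. Poly_Mapping.keys t \<subseteq> {..<n} \<and> total_deg t = m}"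

text \<open>
  A monomial is determined by its list of \<open>n\<close> exponents, which add up to \<open>m\<close>; the number of such
  lists is the stars and bars count.
\<close>

lemma finite_card_monomials:
  assumes "n \<ge> 1"
  shows "finite (monomials n m)" and "card (monomials n m) \<le> (n + m - 1) choose (n - 1)"
proof -
  let ?lists = "{l::nat list. length l = n \<and> sum_list l = m}"
  let ?g = "\<lambda>t. map (Poly_Mapping.lookup t) [0..<n]"
  have inj: "inj_on ?g (monomials n m)"
  proof (rule inj_onI)
    fix s t assume st: "s \<in> monomials n m" "t \<in> monomials n m" "?g s = ?g t"
    show "s = t"
    proof (rule poly_mapping_eqI)
      fix i
      show "Poly_Mapping.lookup s i = Poly_Mapping.lookup t i"
      proof (cases "i < n")
        case True with st(3) show ?thesis by auto
      next
        case False
        with st(1,2) have "i \<notin> Poly_Mapping.keys s" "i \<notin> Poly_Mapping.keys t"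
          by (auto simp: monomials_def)
        then show ?thesis by (simp add: in_keys_iff)
      qed
    qed
  qed
  have sub: "?g ` monomials n m \<subseteq> ?lists"
    by (auto simp: monomials_def total_deg_superset[of "{..<n}"] sum_list_sum_nth atLeast0LessThan)
  have "?lists \<subseteq> {l. set l \<subseteq> {..m} \<and> length l = n}"
    using member_le_sum_list by fastforce
  then have fin: "finite ?lists"
    by (rule finite_subset) (rule finite_lists_length_eq, simp)
  show "finite (monomials n m)"
    using inj sub fin by (rule inj_on_finite)
  have "card (monomials n m) \<le> card ?lists"
    using inj sub fin by (rule card_inj_on_le)
  also have "\<dots> = (m + n - 1) choose m"
    by (rule card_length_sum_list)
  also have "\<dots> = (n + m - 1) choose (n - 1)"
    using assms by (subst binomial_symmetric) (simp_all add: add.commute)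
  finally show "card (monomials n m) \<le> (n + m - 1) choose (n - 1)" .
qed

lemma vector_space_scale: "vector_space scale"
  by unfold_locales (auto intro!: poly_mapping_eqI simp: lookup_scale lookup_add algebra_simps)

lemma poly_mapping_sum_single:
  "p = (\<Sum>t\<in>Poly_Mapping.keys p. Poly_Mapping.single t (Poly_Mapping.lookup p t))"
  by (rule poly_mapping_eqI)
    (auto simp: lookup_sum lookup_single when_def sum.delta' in_keys_iff)

text \<open>
  The polynomials lie in a space spanned by fewer than \<open>r\<close> monomials. Dependence in a vector
  space speaks of the set of values, not of the family, so repeated values are treated apart:
  two equal members have a relation with coefficients \<open>1\<close> and \<open>-1\<close>.
\<close>

lemma lin_dependent_if_few_monomials:
  assumes "finite T" and "card T < r" and supp: "\<And>j. j \<in> {1..r} \<Longrightarrow> Poly_Mapping.keys (g j) \<subseteq> T"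
  shows "lin_dependent r g"
proof (cases "inj_on g {1..r}")
  case False
  then obtain i j where ij: "i \<in> {1..r}" "j \<in> {1..r}" "i \<noteq> j" "g i = g j"
    by (auto simp: inj_on_def)
  define c :: "nat \<Rightarrow> complex" where "c k = (if k = i then 1 else if k = j then - 1 else 0)" for k
  have "(\<Sum>k=1..r. scale (c k) (g k)) = (\<Sum>k\<in>{i, j}. scale (c k) (g k))"
    using ij by (intro sum.mono_neutral_right) (auto simp: c_def scale_eq_mult)
  also have "\<dots> = 0"
    using ij by (auto intro!: poly_mapping_eqI simp: c_def lookup_add lookup_scale)
  finally show ?thesis
    using ij unfolding lin_dependent_def by (intro exI[of _ c]) (auto simp: c_def)
next
  case inj: True
  interpret vs: vector_space scale by (rule vector_space_scale)
  let ?mono = "\<lambda>t. Poly_Mapping.single t (1::complex)"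
  have "p \<in> vs.span (?mono ` T)" if "Poly_Mapping.keys p \<subseteq> T" for p
  proof -
    have "p = (\<Sum>t\<in>Poly_Mapping.keys p. scale (Poly_Mapping.lookup p t) (?mono t))"
      by (subst poly_mapping_sum_single) (simp add: scale_eq_mult mult_single)
    also have "\<dots> \<in> vs.span (?mono ` T)"
      using that by (intro vs.span_sum vs.span_scale vs.span_base) auto
    finally show ?thesis .
  qed
  with supp have span: "g ` {1..r} \<subseteq> vs.span (?mono ` T)"
    by auto
  have "vs.dependent (g ` {1..r})"
  proof (rule ccontr)
    assume "vs.independent (g ` {1..r})"
    with vs.independent_span_bound[OF _ this span] assms(1)
    have "card (g ` {1..r}) \<le> card (?mono ` T)" by simp
    also have "\<dots> \<le> card T" by (rule card_image_le) (rule assms(1))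
    finally show False using assms(2) inj by (simp add: card_image)
  qed
  then obtain u where u: "\<exists>v\<in>g ` {1..r}. u v \<noteq> 0" "(\<Sum>v\<in>g ` {1..r}. scale (u v) v) = 0"
    by (auto simp: vs.dependent_finite)
  have "(\<Sum>j=1..r. scale (u (g j)) (g j)) = 0"
    using u(2) by (simp only: sum.reindex[OF inj] o_def)
  with u(1) show ?thesis
    unfolding lin_dependent_def by (intro exI[of _ "\<lambda>j. u (g j)"]) auto
qed

lemma ticket_contains:
  assumes "n \<ge> 1" and "f \<in> families r n d" and "m \<ge> 1" and "r > (n + m * d - 1) choose (n - 1)"
  shows "m \<in> ticket r f"
proof -
  have "Poly_Mapping.keys (f j ^ m) \<subseteq> monomials n (m * d)" if "j \<in> {1..r}" for j
    using assms(2) that homogeneous_power[of d "f j" m] in_vars_power[of n "f j" m]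
    by (auto simp: families_def monomials_def homogeneous_def in_vars_def)
  then have "lin_dependent r (\<lambda>j. f j ^ m)"
    using finite_card_monomials[OF assms(1), of "m * d"] assms(4)
    by (intro lin_dependent_if_few_monomials[of "monomials n (m * d)"]) auto
  with assms(3) show ?thesis by (simp add: ticket_def)
qed


section \<open>The length of the ticket\<close>

text \<open>
  The maximum that defines \<open>m_bound\<close> is attained because \<open>(n + m - 1) choose (n - 1)\<close> is at least
  \<open>m\<close> for \<open>n \<ge> 2\<close>, which bounds every candidate by \<open>r\<close>.
\<close>

lemma m_bound_property:
  assumes "r \<ge> 2" and "n \<ge> 2"
  shows "r > (n + m_bound r n - 1) choose (n - 1)"
  unfolding m_bound_def
proof (rule GreatestI_nat[where P = "\<lambda>m. r > (n + m - 1) choose (n - 1)" and k = 0 and b = r])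
  show "r > (n + 0 - 1) choose (n - 1)" using assms by simp
next
  fix m assume less: "r > (n + m - 1) choose (n - 1)"
  obtain k where n: "n = Suc (Suc k)" using assms(2) by (metis add_2_eq_Suc le_Suc_ex)
  have "m \<le> (n + m - 1) choose m"
    unfolding n
  proof (induction m)
    case (Suc m)
    obtain p where "k + m choose m = Suc p"
      using gr0_implies_Suc[OF zero_less_binomial[OF le_add2]] by blast
    with Suc show ?case by simp
  qed simp
  also have "\<dots> = (n + m - 1) choose (n - 1)"
    using n by (subst binomial_symmetric) simp_all
  finally show "m \<le> r" using less by simp
qed

theorem theorem2:
  fixes r n :: nat and f :: "nat \<Rightarrow> cpoly"
  assumes "r \<ge> 2" and "n \<ge> 2" and "f \<in> families r n 1"
  shows "\<exists>k. m_bound r n \<le> k \<and> k \<le> r - 2 \<and> ticket r f = {1..k}"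
proof -
  let ?T = "ticket r f"
  \<comment> \<open>inserting \<open>0\<close> gives the empty ticket the right length and also covers \<open>m_bound r n = 0\<close>\<close>
  define k where "k = Max (insert 0 ?T)"
  have upper: "m \<le> r - 2" if "m \<in> ?T" for m
    by (rule ticket_upper_bound[OF assms(1,3) that])
  have fin: "finite (insert 0 ?T)"
    using upper by (intro finite_subset[of "insert 0 ?T" "{..r - 2}"]) auto
  have k_in: "k \<in> insert 0 ?T"
    unfolding k_def by (rule Max_in[OF fin]) simp
  have le_k: "m \<le> k" if "m \<in> insert 0 ?T" for m
    unfolding k_def by (rule Max_ge[OF fin that])
  have "?T = {1..k}"
  proof (intro equalityI subsetI)
    fix m assume "m \<in> ?T"
    with le_k show "m \<in> {1..k}" by (simp add: ticket_def)
  next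
    fix m assume "m \<in> {1..k}"
    with k_in ticket_downward_closed[OF assms(1,3)] show "m \<in> ?T" by auto
  qed
  moreover have "k \<le> r - 2"
    using k_in upper by auto
  moreover have "m_bound r n \<in> insert 0 ?T"
    using ticket_contains[of n f r 1 "m_bound r n"] m_bound_property[OF assms(1,2)] assms(2,3)
    by (cases "m_bound r n = 0") auto
  ultimately show ?thesis
    using le_k by blast
qed

end
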